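(* Let $K\ge 1$. Suppose that $f(z)=h(z)+\overline{g(z)}=\sum_{n=0}^{\infty}a_nz^n+\overline{\sum_{n=1}^{\infty}b_nz^n}$ is a $K$-quasiconformal sense-preserving harmonic mapping in $\mathbb{D}$ and $h\prec\psi$, where $\psi$ is univalent and convex in $\mathbb{D}$. Then $$|h(z)|+\sum_{n=1}^{\infty}(|a_n|+|b_n|)r^n\le|\psi(0)|+\operatorname{dist}(\psi(0),\partial\psi(\mathbb{D}))\quad\text{for } |z|=r\le r_{u,c}=\frac{K+1}{7K+3}.$$ The result is sharp.
   Context: $\mathbb{D}=\{z\in\mathbb{C}:|z|<1\}$. A harmonic mapping $f=h+\overline{g}$ in $\mathbb{D}$ ($h,g$ analytic, $g(0)=0$) is sense-preserving if $J_f=|h'|^2-|g'|^2>0$ in $\mathbb{D}$, equivalently $h'\neq0$ and the dilatation $\omega_f=g'/h'$ satisfies $|\omega_f|<1$ in $\mathbb{D}$. A sense-preserving homeomorphism $f$ of $\mathbb{D}$ onto a domain, in the Sobolev class $W^{1,2}_{loc}(\mathbb{D})$, is $K$-quasiconformal if $\frac{|f_z|+|f_{\bar z}|}{|f_z|-|f_{\bar z}|}\le K$ in $\mathbb{D}$; for $f=h+\overline g$ this means $|\omega_f(z)|\le k=\frac{K-1}{K+1}$, i.e. $|g'(z)|\le k|h'(z)|$ in $\mathbb{D}$. The relation $h\prec\psi$ is the usual subordination: $h=\psi\circ\omega$ for some analytic $\omega:\mathbb{D}\to\mathbb{D}$ with $\omega(0)=0$. "$\psi$ univalent and convex" means $\psi$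 is analytic and injective on $\mathbb{D}$ and $\psi(\mathbb{D})$ is a convex domain. $\operatorname{dist}$ is Euclidean distance. "Sharp" means that, for the given $K$, the number $(K+1)/(7K+3)$ cannot be replaced by any larger one: for every larger radius the inequality fails for some $f,\psi$ satisfying the hypotheses and some $z$. *)

theory Defs
  imports "HOL-Complex_Analysis.Complex_Analysis"
begin

abbreviation unit_disc :: "complex set"  (\<open>\<D>\<close>)
  where "\<D> \<equiv> ball 0 1"

definition wirtinger :: "(complex \<Rightarrow> complex) \<Rightarrow> complex \<Rightarrow> complex" where
  "wirtinger f z =
     (frechet_derivative f (at z) 1 - \<i> * frechet_derivative f (at z) \<i>) / 2"

definition wirtinger_bar :: "(complex \<Rightarrow> complex) \<Rightarrow> complex \<Rightarrow> complex" where
  "wirtinger_bar f z =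
     (frechet_derivative f (at z) 1 + \<i> * frechet_derivative f (at z) \<i>) / 2"

definition jacobian :: "(complex \<Rightarrow> complex) \<Rightarrow> complex \<Rightarrow> real" where
  "jacobian f z = (cmod (wirtinger f z))\<^sup>2 - (cmod (wirtinger_bar f z))\<^sup>2"

definition harmonic_mapping ::
    "(complex \<Rightarrow> complex) \<Rightarrow> (complex \<Rightarrow> complex) \<Rightarrow> (complex \<Rightarrow> complex) \<Rightarrow> bool" where
  "harmonic_mapping f h g \<longleftrightarrow>
     h holomorphic_on \<D> \<and> g holomorphic_on \<D> \<and> g 0 = 0 \<and>
     (\<forall>z\<in>\<D>. f z = h z + cnj (g z))"

definition sense_preserving :: "(complex \<Rightarrow> complex) \<Rightarrow> bool" where
  "sense_preserving f \<longleftrightarrow> (\<forall>z\<in>\<D>. f differentiable (at z) \<and> jacobian f z > 0)"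

lemma harmonic_mapping_has_derivative:
  assumes "harmonic_mapping f h g" "z \<in> \<D>"
  shows "(f has_derivative (\<lambda>v. deriv h z * v + cnj (deriv g z * v))) (at z)"
proof -
  have "(h has_field_derivative deriv h z) (at z)" "(g has_field_derivative deriv g z) (at z)"
    using assms by (auto simp: harmonic_mapping_def intro: holomorphic_derivI)
  then have "(h has_derivative (\<lambda>v. deriv h z * v)) (at z)"
    "(g has_derivative (\<lambda>v. deriv g z * v)) (at z)"
    by (auto simp: has_field_derivative_def)
  then have "((\<lambda>w. h w + cnj (g w)) has_derivative
      (\<lambda>v. deriv h z * v + cnj (deriv g z * v))) (at z)"
    by (intro has_derivative_add has_derivative_cnj)
  then show ?thesis
    by (rule has_derivative_transform_within_open[OF _ open_ball assms(2)])
       (use assms in \<open>auto simp: harmonic_mapping_def\<close>)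
qed

lemma harmonic_mapping_wirtinger:
  assumes "harmonic_mapping f h g" "z \<in> \<D>"
  shows "wirtinger f z = deriv h z" "wirtinger_bar f z = cnj (deriv g z)"
  using frechet_derivative_at[OF harmonic_mapping_has_derivative[OF assms], symmetric]
  by (simp_all add: wirtinger_def wirtinger_bar_def algebra_simps)

lemma harmonic_mapping_sense_preserving_iff:
  assumes "harmonic_mapping f h g"
  shows "sense_preserving f \<longleftrightarrow>
    (\<forall>z\<in>\<D>. (cmod (deriv h z))\<^sup>2 - (cmod (deriv g z))\<^sup>2 > 0)"
proof -
  have "f differentiable (at z)" if "z \<in> \<D>" for z
    using harmonic_mapping_has_derivative[OF assms that] unfolding differentiable_def by blast
  then show ?thesis
    by (simp add: sense_preserving_def jacobian_def harmonic_mapping_wirtinger[OF assms])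
qed

definition locally_L2 :: "complex set \<Rightarrow> (complex \<Rightarrow> complex) \<Rightarrow> bool" where
  "locally_L2 U f \<longleftrightarrow>
     set_borel_measurable lebesgue U f \<and>
     (\<forall>C. compact C \<and> C \<subseteq> U \<longrightarrow> set_integrable lebesgue C (\<lambda>z. (cmod (f z))\<^sup>2))"

text \<open>Test functions are of class \<open>C\<^sup>1\<close> with compact support in \<open>U\<close>, as is enough for
  first-order weak derivatives (by mollification, \<open>C\<close>-infinity test functions give the
  same notion).\<close>

definition test_function :: "complex set \<Rightarrow> (complex \<Rightarrow> real) \<Rightarrow> bool" where
  "test_function U \<phi> \<longleftrightarrow>
     (\<forall>z. \<phi> differentiable (at z)) \<and>
     (\<forall>v. continuous_on UNIV (\<lambda>z. frechet_derivative \<phi> (at z) v)) \<and>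
     compact (closure {z. \<phi> z \<noteq> 0}) \<and> closure {z. \<phi> z \<noteq> 0} \<subseteq> U"

definition weak_derivative ::
    "complex set \<Rightarrow> complex \<Rightarrow> (complex \<Rightarrow> complex) \<Rightarrow> (complex \<Rightarrow> complex) \<Rightarrow> bool" where
  "weak_derivative U v f u \<longleftrightarrow>
     (\<forall>\<phi>. test_function U \<phi> \<longrightarrow>
        (LINT z:U|lebesgue. frechet_derivative \<phi> (at z) v *\<^sub>R f z) =
        - (LINT z:U|lebesgue. \<phi> z *\<^sub>R u z))"

definition sobolev_1_2_loc :: "complex set \<Rightarrow> (complex \<Rightarrow> complex) \<Rightarrow> bool" where
  "sobolev_1_2_loc U f \<longleftrightarrow>
     locally_L2 U f \<and>
     (\<forall>v\<in>{1, \<i>}. \<exists>u. locally_L2 U u \<and> weak_derivative U v f u)"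

text \<open>For a general Sobolev homeomorphism the derivatives below would be weak ones and the
  inequality would be required almost everywhere. Here \<^const>\<open>sense_preserving\<close> makes \<open>f\<close>
  differentiable throughout the disc, with a positive denominator, and the inequality is
  imposed at every point.\<close>

definition quasiconformal :: "real \<Rightarrow> (complex \<Rightarrow> complex) \<Rightarrow> bool" where
  "quasiconformal K f \<longleftrightarrow>
     sense_preserving f \<and>
     open (f ` \<D>) \<and> connected (f ` \<D>) \<and>
     (\<exists>f'. homeomorphism \<D> (f ` \<D>) f f') \<and>
     sobolev_1_2_loc \<D> f \<and>
     (\<forall>z\<in>\<D>. (cmod (wirtinger f z) + cmod (wirtinger_bar f z)) /
             (cmod (wirtinger f z) - cmod (wirtinger_bar f z)) \<le> K)"

definition subordinate :: "(complex \<Rightarrow> complex) \<Rightarrow> (complex \<Rightarrow> complex) \<Rightarrow> bool"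
    (infix \<open>\<prec>\<^sub>s\<close> 50) where
  "h \<prec>\<^sub>s \<psi> \<longleftrightarrow>
     (\<exists>\<omega>. \<omega> holomorphic_on \<D> \<and> \<omega> ` \<D> \<subseteq> \<D> \<and> \<omega> 0 = 0 \<and> (\<forall>z\<in>\<D>. h z = \<psi> (\<omega> z)))"

text \<open>The image is automatically a domain, by the open mapping theorem.\<close>

definition univalent_convex :: "(complex \<Rightarrow> complex) \<Rightarrow> bool" where
  "univalent_convex \<psi> \<longleftrightarrow> \<psi> holomorphic_on \<D> \<and> inj_on \<psi> \<D> \<and> convex (\<psi> ` \<D>)"

definition bohr_hypotheses ::
    "real \<Rightarrow> (complex \<Rightarrow> complex) \<Rightarrow> (complex \<Rightarrow> complex) \<Rightarrow> (complex \<Rightarrow> complex) \<Rightarrow>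
     (nat \<Rightarrow> complex) \<Rightarrow> (nat \<Rightarrow> complex) \<Rightarrow> (complex \<Rightarrow> complex) \<Rightarrow> bool" where
  "bohr_hypotheses K f h g a b \<psi> \<longleftrightarrow>
     harmonic_mapping f h g \<and>
     (\<forall>z\<in>\<D>. (\<lambda>n. a n * z ^ n) sums h z) \<and>
     (\<forall>z\<in>\<D>. (\<lambda>n. b (Suc n) * z ^ Suc n) sums g z) \<and>
     sense_preserving f \<and> quasiconformal K f \<and>
     univalent_convex \<psi> \<and> h \<prec>\<^sub>s \<psi>"

text \<open>On the disc the series below converges, since the power series of \<open>h\<close> and \<open>g\<close> converge
  absolutely there. By Liouville's theorem \<open>\<psi> ` \<D>\<close> is not the whole plane, so its frontier is
  nonempty and \<^const>\<open>infdist\<close> is the genuine distance.\<close>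

definition bohr_inequality ::
    "(complex \<Rightarrow> complex) \<Rightarrow> (nat \<Rightarrow> complex) \<Rightarrow> (nat \<Rightarrow> complex) \<Rightarrow>
     (complex \<Rightarrow> complex) \<Rightarrow> complex \<Rightarrow> bool" where
  "bohr_inequality h a b \<psi> z \<longleftrightarrow>
     cmod (h z) + (\<Sum>n. (cmod (a (Suc n)) + cmod (b (Suc n))) * cmod z ^ Suc n)
       \<le> cmod (\<psi> 0) + infdist (\<psi> 0) (frontier (\<psi> ` \<D>))"

end

theory Submission
  imports Defs
begin

text \<open>Write \<open>k = (K - 1)/(K + 1)\<close> and \<open>d = dist(\<psi>(0), \<partial>\<psi>(\<D>))\<close>. Convexity puts \<open>\<psi>(\<D>)\<close>, hence
  \<open>h(\<D>)\<close>, into a half-plane whose boundary has distance at most \<open>d\<close> from \<open>\<psi>(0) = h(0)\<close>, and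
  Caratheodory's inequality gives \<open>\<bar>a\<^sub>n\<bar> \<le> 2d\<close>. The same inequality yields Bohr's theorem for the
  dilatation \<open>g'/h'\<close>, so \<open>\<Sum>\<bar>b\<^sub>n\<bar>r\<^sup>n \<le> k \<Sum>\<bar>a\<^sub>n\<bar>r\<^sup>n\<close> for \<open>r \<le> 1/3\<close>. The left-hand side is therefore at
  most \<open>\<bar>\<psi>(0)\<bar> + 2(2 + k)d r/(1 - r)\<close>, which is bounded by \<open>\<bar>\<psi>(0)\<bar> + d\<close> exactly when
  \<open>r \<le> 1/(5 + 2k) = (K + 1)/(7K + 3)\<close>. Equality throughout occurs for \<open>\<psi> = h = z/(1 - z)\<close> and
  \<open>g = k h\<close>, where \<open>f\<close> is the composition of \<open>h\<close> with a real-linear map.\<close>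

subsection \<open>Sobolev regularity of continuously differentiable functions\<close>

lemma integrable_continuous_compact_support:
  fixes F :: "'a::euclidean_space \<Rightarrow> 'b::{banach, second_countable_topology}"
  assumes "continuous_on UNIV F" "compact S" "\<And>z. z \<notin> S \<Longrightarrow> F z = 0"
  shows "integrable lborel F"
proof -
  have "integrable lborel (\<lambda>x. indicator S x *\<^sub>R F x)"
    using assms by (intro borel_integrable_compact) (auto intro: continuous_on_subset)
  also have "(\<lambda>x. indicator S x *\<^sub>R F x) = F"
    using assms(3) by (auto simp: fun_eq_iff indicator_def)
  finally show ?thesis .
qed

lemma lborel_integral_translate:
  fixes F :: "'a::euclidean_space \<Rightarrow> 'b::{banach, second_countable_topology}"
  assumes "F \<in> borel_measurable borel"
  shows "(\<integral>z. F (c + z) \<partial>lborel) = (\<integral>z. F z \<partial>lborel)"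
proof -
  have "(\<integral>z. F z \<partial>lborel) = (\<integral>z. F z \<partial>distr lborel borel ((+) c))"
    by (simp add: lborel_distr_plus)
  also have "\<dots> = (\<integral>z. F (c + z) \<partial>lborel)"
    using assms by (intro integral_distr) auto
  finally show ?thesis by simp
qed

text \<open>Supplies the pointwise limit for a dominated convergence argument; the arbitrary filter
  lets the step size run through a sequence.\<close>

lemma has_derivative_imp_difference_quotient_tendsto:
  fixes F :: "'a::real_normed_vector \<Rightarrow> 'b::real_normed_vector"
  assumes "(F has_derivative D) (at z)" "(X \<longlongrightarrow> 0) \<F>" "eventually (\<lambda>n. X n \<noteq> (0::real)) \<F>"
  shows "((\<lambda>n. (F (X n *\<^sub>R v + z) - F z) /\<^sub>R X n) \<longlongrightarrow> D v) \<F>"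
proof -
  have D: "linear D" using assms(1) by (rule has_derivative_linear)
  have "((\<lambda>t::real. F (t *\<^sub>R v + z)) has_derivative (\<lambda>h. D (h *\<^sub>R v))) (at 0)"
    by (rule has_derivative_compose[where g = F and f = "\<lambda>t. t *\<^sub>R v + z"])
       (use assms(1) in \<open>auto intro!: derivative_eq_intros\<close>)
  then have "((\<lambda>h. norm (F (h *\<^sub>R v + z) - F z - D (h *\<^sub>R v)) / norm h) \<longlongrightarrow> 0) (at 0)"
    by (simp add: has_derivative_at)
  moreover have "filterlim X (at 0) \<F>"
    using assms by (simp add: filterlim_at)
  ultimately have "((\<lambda>n. norm (F (X n *\<^sub>R v + z) - F z - D (X n *\<^sub>R v)) / norm (X n)) \<longlongrightarrow> 0) \<F>"
    by (rule filterlim_compose)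
  moreover have *: "norm (F (X n *\<^sub>R v + z) - F z - D (X n *\<^sub>R v)) / norm (X n) =
      norm ((F (X n *\<^sub>R v + z) - F z) /\<^sub>R X n - D v)" if "X n \<noteq> 0" for n
  proof -
    have "(F (X n *\<^sub>R v + z) - F z) /\<^sub>R X n - D v =
        inverse (X n) *\<^sub>R (F (X n *\<^sub>R v + z) - F z - D (X n *\<^sub>R v))"
      using that by (simp add: linear_scale[OF D] scaleR_diff_right)
    then show ?thesis by (simp add: divide_inverse_commute)
  qed
  ultimately have "((\<lambda>n. norm ((F (X n *\<^sub>R v + z) - F z) /\<^sub>R X n - D v)) \<longlongrightarrow> 0) \<F>"
    by (rule Lim_transform_eventually[OF _ eventually_mono[OF assms(3)]])
  then show ?thesis
    by (simp add: tendsto_norm_zero_iff LIM_zero_iff)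
qed

text \<open>By translation invariance the difference quotients of \<open>F\<close> have integral zero; let the step
  tend to zero.\<close>

lemma integral_derivative_compact_support:
  fixes F :: "'a::euclidean_space \<Rightarrow> 'b::euclidean_space"
  assumes F': "\<And>z. (F has_derivative F' z) (at z)"
    and cont: "continuous_on UNIV (\<lambda>z. F' z v)"
    and S: "compact S" "\<And>z. z \<notin> S \<Longrightarrow> F z = 0"
  shows "(\<integral>z. F' z v \<partial>lborel) = 0"
proof -
  have contF: "continuous_on UNIV F"
    by (intro continuous_at_imp_continuous_on ballI has_derivative_continuous[OF F'])
  \<comment> \<open>Off the closed set \<open>S\<close> the function vanishes in a whole
    neighbourhood, so its derivative vanishes as well.\<close>
  have F'0: "F' z v = 0" if "z \<notin> S" for z
  proof -
    have "((\<lambda>_. 0) has_derivative F' z) (at z)"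
      by (rule has_derivative_transform_within_open[OF F', where s = "- S"])
         (use that S in \<open>auto simp: compact_imp_closed open_Compl\<close>)
    then have "F' z = (\<lambda>_. 0)"
      using has_derivative_unique has_derivative_const by blast
    then show ?thesis by simp
  qed
  obtain B where B: "\<And>z. norm (F' z v) \<le> B"
  proof -
    have "bounded ((\<lambda>z. F' z v) ` S)"
      using S cont by (intro compact_imp_bounded compact_continuous_image)
        (auto intro: continuous_on_subset)
    then obtain B where "B > 0" "\<And>z. z \<in> S \<Longrightarrow> norm (F' z v) \<le> B"
      by (auto simp: bounded_pos)
    then have "norm (F' z v) \<le> B" for z using F'0[of z] by (cases "z \<in> S") auto
    then show ?thesis using that by blast
  qed
  \<comment> \<open>The mean value inequality along the line in direction \<open>v\<close> bounds
    all difference quotients by \<open>B\<close>, uniformly in the step.\<close>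
  have lip: "norm (F (t *\<^sub>R v + z) - F z) \<le> B * t" if "t \<ge> 0" for t z
  proof -
    have lin: "linear (F' w)" for w using F' by (rule has_derivative_linear)
    have "norm (F (t *\<^sub>R v + z) - F (0 *\<^sub>R v + z)) \<le> B * norm (t - 0)"
    proof (rule differentiable_bound)
      show "convex (UNIV :: real set)" by simp
      show "((\<lambda>t. F (t *\<^sub>R v + z)) has_derivative (\<lambda>h. F' (s *\<^sub>R v + z) (h *\<^sub>R v))) (at s within UNIV)"
        for s
        by (rule has_derivative_compose[where g = F and f = "\<lambda>t. t *\<^sub>R v + z"])
           (use F' in \<open>auto intro!: derivative_eq_intros\<close>)
      show "onorm (\<lambda>h. F' (s *\<^sub>R v + z) (h *\<^sub>R v)) \<le> B" for s
        using B[of "s *\<^sub>R v + z"]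
        by (intro onorm_le) (simp add: linear_scale[OF lin] mult.commute[of B] mult_left_mono)
    qed auto
    then show ?thesis using that by simp
  qed
  obtain M where M: "\<And>z. z \<in> S \<Longrightarrow> norm z \<le> M"
    using compact_imp_bounded[OF S(1)] by (auto simp: bounded_iff)
  \<comment> \<open>Steps are at most 1, so a translate by \<open>X n *\<^sub>R v\<close> moves the
    support by at most \<open>norm v\<close>; hence all quotients vanish off this one ball, which
    gives an integrable majorant.\<close>
  define T where "T = cball (0::'a) (M + norm v)"
  define X where "X n = inverse (real (Suc n))" for n
  have X: "0 < X n" "X n \<le> 1" for n by (auto simp: X_def divide_simps)
  have X0: "X \<longlonglongrightarrow> 0" unfolding X_def by (rule LIMSEQ_inverse_real_of_nat)
  define Q where "Q n z = (F (X n *\<^sub>R v + z) - F z) /\<^sub>R X n" for n z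
  have intF: "integrable lborel F"
    by (rule integrable_continuous_compact_support[OF contF S])
  have intFt: "integrable lborel (\<lambda>z. F (c + z))" for c
  proof -
    have "integrable (distr lborel borel ((+) c)) F"
      using intF by (simp add: lborel_distr_plus)
    then show ?thesis
      by (subst (asm) integrable_distr_eq) (use contF in \<open>auto simp: borel_measurable_continuous_onI\<close>)
  qed
  have "(\<integral>z. Q n z \<partial>lborel) = 0" for n
  proof -
    have "(\<integral>z. F (X n *\<^sub>R v + z) \<partial>lborel) = (\<integral>z. F z \<partial>lborel)"
      by (rule lborel_integral_translate) (use contF in \<open>simp add: borel_measurable_continuous_onI\<close>)
    then show ?thesis
      unfolding Q_def using intF intFt[of "X n *\<^sub>R v"] by simp
  qed
  moreover have "(\<lambda>n. \<integral>z. Q n z \<partial>lborel) \<longlonglongrightarrow> (\<integral>z. F' z v \<partial>lborel)"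
  proof (rule integral_dominated_convergence)
    show "(\<lambda>z. F' z v) \<in> borel_measurable lborel"
      using cont by (simp add: borel_measurable_continuous_onI)
    show "Q n \<in> borel_measurable lborel" for n
      unfolding Q_def using intF intFt[of "X n *\<^sub>R v"] by simp
    show "integrable lborel (\<lambda>z. indicator T z *\<^sub>R B)"
      unfolding T_def by (intro borel_integrable_compact) auto
    have "Q n z = 0" if "z \<notin> T" for n z
    proof -
      have "z \<notin> S" using that M[of z] norm_ge_zero[of v] by (auto simp: T_def)
      moreover have "X n *\<^sub>R v + z \<notin> S"
      proof
        assume "X n *\<^sub>R v + z \<in> S"
        from M[OF this] have "norm z \<le> M + norm (X n *\<^sub>R v)"
          using norm_triangle_ineq4[of "X n *\<^sub>R v + z" "X n *\<^sub>R v"] by simp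
        moreover have "norm (X n *\<^sub>R v) \<le> norm v"
          using X[of n] by (simp add: mult_left_le_one_le)
        ultimately show False using that by (simp add: T_def)
      qed
      ultimately show ?thesis by (simp add: Q_def S)
    qed
    moreover have "norm (Q n z) \<le> B" for n z
    proof -
      have "norm (Q n z) = norm (F (X n *\<^sub>R v + z) - F z) / X n"
        using X[of n] by (simp add: Q_def divide_inverse_commute)
      then show ?thesis
        using lip[of "X n" z] X[of n] by (simp add: pos_divide_le_eq)
    qed
    ultimately show "AE z in lborel. norm (Q n z) \<le> indicator T z *\<^sub>R B" for n
      by (intro AE_I2) (auto simp: indicator_def)
    show "AE z in lborel. (\<lambda>n. Q n z) \<longlonglongrightarrow> F' z v"
      unfolding Q_def
      by (intro AE_I2 has_derivative_imp_difference_quotient_tendsto F' X0 always_eventually allI)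
         (use X in \<open>auto simp: less_imp_neq[symmetric]\<close>)
  qed
  ultimately show ?thesis by (simp add: LIMSEQ_const_iff)
qed

lemma continuous_on_imp_locally_L2:
  assumes "open U" "continuous_on U f"
  shows "locally_L2 U f"
  unfolding locally_L2_def
proof (intro conjI allI impI)
  have "(\<lambda>x. indicat_real U x *\<^sub>R f x) \<in> borel_measurable borel"
    using assms by (intro borel_measurable_continuous_on_indicator) auto
  then show "set_borel_measurable lebesgue U f"
    unfolding set_borel_measurable_def by (simp add: measurable_completion)
next
  fix C assume C: "compact C \<and> C \<subseteq> U"
  have "integrable lborel (\<lambda>x. indicator C x *\<^sub>R (cmod (f x))\<^sup>2)"
    using C assms by (intro borel_integrable_compact continuous_intros) (auto intro: continuous_on_subset)
  then show "set_integrable lebesgue C (\<lambda>z. (cmod (f z))\<^sup>2)"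
    unfolding set_integrable_def
    by (subst integrable_completion) (auto dest: borel_measurable_integrable)
qed

text \<open>Integration by parts: the product \<open>\<phi> f\<close>, extended by zero outside
  \<open>U\<close>, is differentiable on the whole plane with compact support. Its derivative in
  direction \<open>v\<close> has integral zero, and the product rule splits that integral into the
  two sides.\<close>

lemma C1_imp_weak_derivative:
  assumes U: "open U"
    and f': "\<And>z. z \<in> U \<Longrightarrow> (f has_derivative f' z) (at z)"
    and cont: "continuous_on U (\<lambda>z. f' z v)"
  shows "weak_derivative U v f (\<lambda>z. f' z v)"
  unfolding weak_derivative_def
proof (intro allI impI)
  fix \<phi> assume \<phi>: "test_function U \<phi>"
  define S where "S = closure {z. \<phi> z \<noteq> 0}"
  have S: "compact S" "closed S" "S \<subseteq> U"
    using \<phi> by (auto simp: test_function_def S_def)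
  have \<phi>0: "\<phi> z = 0" if "z \<notin> S" for z
    using that closure_subset by (force simp: S_def)
  define \<phi>' where "\<phi>' z = frechet_derivative \<phi> (at z)" for z
  have \<phi>': "(\<phi> has_derivative \<phi>' z) (at z)" for z
    using \<phi> unfolding \<phi>'_def test_function_def by (metis frechet_derivative_works)
  have \<phi>'0: "\<phi>' z = (\<lambda>_. 0)" if "z \<notin> S" for z
  proof -
    have "((\<lambda>_. 0) has_derivative \<phi>' z) (at z)"
      by (rule has_derivative_transform_within_open[OF \<phi>', where s = "- S"])
         (use that S \<phi>0 in \<open>auto simp: open_Compl\<close>)
    then show ?thesis
      using has_derivative_unique has_derivative_const by blast
  qed
  have cont\<phi>': "continuous_on UNIV (\<lambda>z. \<phi>' z v)"
    using \<phi> by (auto simp: test_function_def \<phi>'_def)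
  have cont\<phi>: "continuous_on UNIV \<phi>"
    by (intro continuous_at_imp_continuous_on ballI has_derivative_continuous[OF \<phi>'])
  have contf: "continuous_on U f"
    by (intro continuous_at_imp_continuous_on ballI has_derivative_continuous[OF f'])
  \<comment> \<open>Extension by zero stays continuous because \<open>U\<close> and the complement
    of \<open>S\<close> are open, cover the plane and the extension is continuous on each.\<close>
  have ext: "continuous_on UNIV (\<lambda>z. indicat_real U z *\<^sub>R G z)" (is "continuous_on _ ?G")
    if "continuous_on U G" "\<And>z. z \<notin> S \<Longrightarrow> G z = 0" for G :: "complex \<Rightarrow> complex"
  proof -
    have "continuous_on (U \<union> - S) ?G"
    proof (rule continuous_on_open_Un)
      show "continuous_on U ?G"
        using that(1) by (rule continuous_on_eq) auto
      show "continuous_on (- S) ?G"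
        by (rule continuous_on_eq[OF continuous_on_const[of _ 0]]) (use that in auto)
    qed (use U S in auto)
    moreover have "U \<union> - S = UNIV" using S by auto
    ultimately show ?thesis by simp
  qed
  define A where "A z = indicat_real U z *\<^sub>R (\<phi>' z v *\<^sub>R f z)" for z
  define B where "B z = indicat_real U z *\<^sub>R (\<phi> z *\<^sub>R f' z v)" for z
  have contA: "continuous_on UNIV A"
    unfolding A_def using \<phi>'0 cont\<phi>' contf
    by (intro ext continuous_intros) (auto intro: continuous_on_subset)
  have contB: "continuous_on UNIV B"
    unfolding B_def using \<phi>0 cont\<phi> cont
    by (intro ext continuous_intros) (auto intro: continuous_on_subset)
  have intA: "integrable lborel A"
    using contA S(1) by (rule integrable_continuous_compact_support) (simp add: A_def \<phi>'0)
  have intB: "integrable lborel B"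
    using contB S(1) by (rule integrable_continuous_compact_support) (simp add: B_def \<phi>0)
  define F where "F z = indicat_real U z *\<^sub>R (\<phi> z *\<^sub>R f z)" for z
  define F' where "F' z w = indicat_real U z *\<^sub>R (\<phi> z *\<^sub>R f' z w + \<phi>' z w *\<^sub>R f z)" for z w
  have "(F has_derivative F' z) (at z)" for z
  proof (cases "z \<in> U")
    case True
    have "((\<lambda>z. \<phi> z *\<^sub>R f z) has_derivative (\<lambda>w. \<phi> z *\<^sub>R f' z w + \<phi>' z w *\<^sub>R f z)) (at z)"
      by (rule has_derivative_scaleR[OF \<phi>' f'[OF True]])
    moreover have "(\<lambda>w. \<phi> z *\<^sub>R f' z w + \<phi>' z w *\<^sub>R f z) = F' z"
      using True by (simp add: F'_def fun_eq_iff)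
    ultimately show ?thesis
      using U True by (auto simp: F_def intro: has_derivative_transform_within_open[where s = U])
  next
    case False
    then have "z \<in> - S" using S by auto
    moreover have "F' z = (\<lambda>_. 0)" using False by (simp add: F'_def fun_eq_iff)
    moreover have "((\<lambda>_. 0) has_derivative (\<lambda>_. 0)) (at z)" by simp
    then have "(F has_derivative (\<lambda>_. 0)) (at z)"
      by (rule has_derivative_transform_within_open[where s = "- S"])
         (use \<open>z \<in> - S\<close> S \<phi>0 in \<open>simp_all add: F_def open_Compl\<close>)
    ultimately show ?thesis by simp
  qed
  moreover have F'v: "(\<lambda>z. F' z v) = (\<lambda>z. A z + B z)"
    by (auto simp: F'_def A_def B_def scaleR_add_right fun_eq_iff)
  moreover have "continuous_on UNIV (\<lambda>z. F' z v)"
    unfolding F'v by (intro continuous_intros contA contB)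
  moreover have "F z = 0" if "z \<notin> S" for z using that \<phi>0 by (simp add: F_def)
  ultimately have "(\<integral>z. F' z v \<partial>lborel) = 0"
    using S(1) by (intro integral_derivative_compact_support[where F = F and S = S])
  then have "integral\<^sup>L lborel A = - integral\<^sup>L lborel B"
    unfolding F'v using intA intB by (simp add: eq_neg_iff_add_eq_0)
  \<comment> \<open>Weak derivatives are phrased with Lebesgue measure; for Borel functions,
    completing the measure does not change the integral.\<close>
  moreover have "integral\<^sup>L lebesgue A = integral\<^sup>L lborel A" "integral\<^sup>L lebesgue B = integral\<^sup>L lborel B"
    using contA contB by (auto intro!: integral_completion borel_measurable_continuous_onI)
  ultimately show "(LINT z:U|lebesgue. frechet_derivative \<phi> (at z) v *\<^sub>R f z) =
      - (LINT z:U|lebesgue. \<phi> z *\<^sub>R f' z v)"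
    unfolding set_lebesgue_integral_def A_def[abs_def] B_def[abs_def] \<phi>'_def by simp
qed

lemma C1_imp_sobolev_1_2_loc:
  assumes "open U"
    and "\<And>z. z \<in> U \<Longrightarrow> (f has_derivative f' z) (at z)"
    and "\<And>v. continuous_on U (\<lambda>z. f' z v)"
  shows "sobolev_1_2_loc U f"
  unfolding sobolev_1_2_loc_def
proof (intro conjI ballI exI)
  show "locally_L2 U f"
    using assms(1) by (rule continuous_on_imp_locally_L2)
      (intro continuous_at_imp_continuous_on ballI has_derivative_continuous[OF assms(2)])
  show "locally_L2 U (\<lambda>z. f' z v)" for v
    using assms(1,3) by (rule continuous_on_imp_locally_L2)
  show "weak_derivative U v f (\<lambda>z. f' z v)" for v
    using assms by (rule C1_imp_weak_derivative)
qed

subsection \<open>Coefficient bounds and majorant series\<close>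

text \<open>Multiply \<open>p\<close> by the nonnegative kernel \<open>2 + 2 Re (\<alpha> (\<rho>/z)\<^sup>n)\<close> on the circle of radius
  \<open>\<rho>\<close> and average: the real part of the result, \<open>2 Re p\<^sub>0 + Re (\<alpha> p\<^sub>n \<rho>\<^sup>n)\<close>, is
  nonnegative for every unimodular \<open>\<alpha>\<close>.\<close>

lemma caratheodory_coeff_bound:
  assumes holo: "p holomorphic_on ball 0 1" and pos: "\<And>z. z \<in> ball 0 1 \<Longrightarrow> 0 \<le> Re (p z)"
    and exp: "p has_fps_expansion P" and n: "n > 0"
  shows "cmod (fps_nth P n) \<le> 2 * Re (p 0)"
proof -
  define c where "c = fps_nth P n"
  have scaled: "cmod c * \<rho> ^ n \<le> 2 * Re (p 0)" if \<rho>: "0 < \<rho>" "\<rho> < 1" for \<rho> :: real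
  proof -
    \<comment> \<open>This unimodular factor turns \<open>c\<close> onto the negative real axis, the
      worst direction, where nonnegativity of the average becomes the bound on
      \<open>cmod c\<close>.\<close>
    define \<alpha> where "\<alpha> = (if c = 0 then 1 else - cnj c / cmod c)"
    have \<alpha>: "cmod \<alpha> = 1" by (auto simp: \<alpha>_def norm_divide)
    have \<alpha>c: "\<alpha> * c = - cmod c"
      using complex_norm_square[of c]
      by (auto simp: \<alpha>_def field_simps power2_eq_square)
    \<comment> \<open>By Cauchy's formulas \<open>F z / z\<close> contributes
      \<open>2 * p 0\<close>, as the power vanishes at 0 for \<open>n > 0\<close>, and the other
      term of \<open>G\<close> extracts \<open>c\<close>. On the circle of radius \<rho> the two
      powers are conjugate to each other, so together they form the real kernel.\<close>
    define F where "F z = p z * (2 + cnj \<alpha> * (z / \<rho>) ^ n)" for z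
    define G where "G z = F z / (z - 0) + (\<alpha> * \<rho> ^ n) * (p z / (z - 0) ^ Suc n)" for z
    have holc: "p holomorphic_on cball 0 \<rho>"
      using \<rho> by (intro holomorphic_on_subset[OF holo]) auto
    have "((\<lambda>z. F z / (z - 0)) has_contour_integral (2 * of_real pi * \<i> * F 0)) (circlepath 0 \<rho>)"
      unfolding F_def using \<rho>
      by (intro Cauchy_integral_circlepath_simple holomorphic_intros holc) auto
    moreover have "((\<lambda>z. p z / (z - 0) ^ Suc n) has_contour_integral
        ((2 * pi * \<i>) / (fact n) * (deriv ^^ n) p 0)) (circlepath 0 \<rho>)"
      using \<rho> by (intro Cauchy_has_contour_integral_higher_derivative_circlepath
          holomorphic_on_imp_continuous_on holc holomorphic_on_subset[OF holc]) auto
    ultimately have "(G has_contour_integral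
        (2 * of_real pi * \<i> * F 0 + (\<alpha> * \<rho> ^ n) * ((2 * pi * \<i>) / (fact n) * (deriv ^^ n) p 0)))
        (circlepath 0 \<rho>)"
      unfolding G_def by (intro has_contour_integral_add has_contour_integral_lmul)
    moreover have "2 * of_real pi * \<i> * F 0 + (\<alpha> * \<rho> ^ n) * ((2 * pi * \<i>) / (fact n) * (deriv ^^ n) p 0)
        = 2 * of_real pi * \<i> * (2 * p 0 - cmod c * \<rho> ^ n)"
    proof -
      have "(deriv ^^ n) p 0 / fact n = c" using fps_nth_fps_expansion[OF exp, of n] by (simp add: c_def)
      then have "(\<alpha> * \<rho> ^ n) * ((2 * pi * \<i>) / (fact n) * (deriv ^^ n) p 0)
          = 2 * of_real pi * \<i> * ((\<alpha> * c) * \<rho> ^ n)" by (simp add: field_simps)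
      then show ?thesis using n by (simp add: F_def \<alpha>c algebra_simps)
    qed
    ultimately have "(G has_contour_integral (2 * of_real pi * \<i> * (2 * p 0 - cmod c * \<rho> ^ n)))
        (circlepath 0 \<rho>)" by simp
    then have int: "((\<lambda>x. G (circlepath 0 \<rho> x) * vector_derivative (circlepath 0 \<rho>) (at x within {0..1}))
        has_integral (2 * of_real pi * \<i> * (2 * p 0 - cmod c * \<rho> ^ n))) {0..1}"
      by (simp add: has_contour_integral_def)
    have "bounded_linear (\<lambda>w. Re (w / (2 * of_real pi * \<i>)))"
      by (intro bounded_linear_compose[OF bounded_linear_Re] bounded_linear_divide)
    from has_integral_linear[OF int this]
    have "((\<lambda>x. Re (G (circlepath 0 \<rho> x) * vector_derivative (circlepath 0 \<rho>) (at x within {0..1})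
        / (2 * of_real pi * \<i>))) has_integral (Re (2 * p 0 - cmod c * \<rho> ^ n))) {0..1}"
      by (simp add: o_def)
    moreover have "0 \<le> Re (G (circlepath 0 \<rho> x) * vector_derivative (circlepath 0 \<rho>) (at x within {0..1})
        / (2 * of_real pi * \<i>))" if x: "x \<in> {0..1}" for x
    proof -
      define e where "e = exp (2 * of_real pi * \<i> * of_real x)"
      have e: "cmod e = 1" "e \<noteq> 0" by (auto simp: e_def)
      have cnj_e: "1 / e = cnj e"
        using complex_norm_square[of e] e by (simp add: field_simps)
      define w where "w = \<alpha> * cnj e ^ n"
      have "cmod w = 1" by (simp add: w_def norm_mult norm_power \<alpha> e)
      then have w: "- 1 \<le> Re w" using abs_Re_le_cmod[of w] by linarith
      have cancel: "v * (2 * of_real pi * \<i> * w) / (2 * of_real pi * \<i>) = v * w" for v w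
        by (simp add: field_simps)
      have path: "circlepath 0 \<rho> x = \<rho> * e"
        by (simp add: circlepath e_def)
      have "vector_derivative (circlepath 0 \<rho>) (at x within {0..1}) = 2 * of_real pi * \<i> * (\<rho> * e)"
        using x by (simp add: vector_derivative_circlepath01 e_def)
      then have "G (circlepath 0 \<rho> x) * vector_derivative (circlepath 0 \<rho>) (at x within {0..1})
          / (2 * of_real pi * \<i>) = G (\<rho> * e) * (\<rho> * e)"
        unfolding path by (simp only: cancel)
      also have "\<dots> = F (\<rho> * e) + \<alpha> * p (\<rho> * e) * (1 / e) ^ n"
      proof -
        have "(f / (v - 0) + (\<alpha> * w ^ n) * (q / (v - 0) ^ Suc n)) * v = f + \<alpha> * q * (w / v) ^ n"
          if "v \<noteq> 0" for f q v w :: complex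
          using that by (simp add: power_divide distrib_right)
        from this[of "\<rho> * e" "F (\<rho> * e)" \<rho> "p (\<rho> * e)"] show ?thesis
          using \<rho> e unfolding G_def by simp
      qed
      also have "\<dots> = p (\<rho> * e) * (2 + (w + cnj w))"
        using \<rho> unfolding cnj_e by (simp add: F_def w_def algebra_simps)
      also have "\<dots> = p (\<rho> * e) * of_real (2 + 2 * Re w)"
        by (simp add: complex_add_cnj)
      finally show ?thesis
        using w pos[of "\<rho> * e"] \<rho> e by (simp add: norm_mult)
    qed
    ultimately have "0 \<le> Re (2 * p 0 - cmod c * \<rho> ^ n)"
      by (rule has_integral_nonneg)
    then show ?thesis by (simp flip: of_real_power of_real_mult)
  qed
  \<comment> \<open>Nothing is known about \<open>p\<close> on the unit circle itself, so the bound
    is proved for \<rho> < 1 and passed to the limit.\<close>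
  have "((\<lambda>\<rho>. cmod c * \<rho> ^ n) \<longlongrightarrow> cmod c * 1 ^ n) (at_left 1)"
    by (intro tendsto_intros)
  moreover have "eventually (\<lambda>\<rho>. cmod c * \<rho> ^ n \<le> 2 * Re (p 0)) (at_left 1)"
    by (rule eventually_mono[OF eventually_at_left_real[of 0 1]]) (use scaled in auto)
  ultimately have "cmod c * 1 ^ n \<le> 2 * Re (p 0)"
    by (intro tendsto_upperbound) auto
  then show ?thesis by (simp add: c_def)
qed

text \<open>The function \<open>M - u f\<close> has nonnegative real part, and for
  \<open>n > 0\<close> its coefficients have the same modulus as those of \<open>f\<close>.\<close>

lemma half_plane_coeff_bound:
  assumes holo: "f holomorphic_on ball 0 1" and exp: "f has_fps_expansion F"
    and u: "cmod u = 1" and bound: "\<And>z. z \<in> ball 0 1 \<Longrightarrow> Re (u * f z) \<le> M" and n: "n > 0"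
  shows "cmod (fps_nth F n) \<le> 2 * (M - Re (u * f 0))"
proof -
  have "cmod (fps_nth (fps_const (of_real M) - fps_const u * F) n) \<le> 2 * Re (of_real M - u * f 0)"
    by (rule caratheodory_coeff_bound[where p = "\<lambda>z. of_real M - u * f z"])
       (use n bound in \<open>auto intro!: holomorphic_intros holo fps_expansion_intros exp\<close>)
  then show ?thesis using n u by (simp add: norm_mult)
qed

text \<open>Rotating so that \<open>\<phi> 0\<close> becomes nonnegative, the disc of radius
  \<open>k\<close> lies in the half-plane \<open>Re w \<le> k\<close>, whence every later
  coefficient is at most \<open>2 (k - c 0)\<close>. For small \<open>r\<close> the geometric series
  then costs no more than the gap \<open>k - c 0\<close>.\<close>

lemma bohr_majorant_le:
  assumes holo: "\<phi> holomorphic_on ball 0 1" and exp: "\<phi> has_fps_expansion C"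
    and bound: "\<And>z. z \<in> ball 0 1 \<Longrightarrow> cmod (\<phi> z) \<le> k" and r: "0 \<le> r" "r \<le> 1/3"
  shows "summable (\<lambda>n. cmod (fps_nth C n) * r ^ n)" "(\<Sum>n. cmod (fps_nth C n) * r ^ n) \<le> k"
proof -
  define c where "c n = cmod (fps_nth C n)" for n
  have C0: "fps_nth C 0 = \<phi> 0" using fps_nth_fps_expansion[OF exp, of 0] by simp
  have c0: "c 0 \<le> k" using bound[of 0] by (simp add: c_def C0)
  have cn: "c (Suc n) \<le> 2 * (k - c 0)" for n
  proof -
    define u where "u = (if \<phi> 0 = 0 then 1 else cnj (\<phi> 0) / cmod (\<phi> 0))"
    have u: "cmod u = 1" by (auto simp: u_def norm_divide)
    have "u * \<phi> 0 = cmod (\<phi> 0)"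
      using complex_norm_square[of "\<phi> 0"] by (auto simp: u_def field_simps power2_eq_square)
    moreover have "Re (u * \<phi> z) \<le> k" if "z \<in> ball 0 1" for z
      using complex_Re_le_cmod[of "u * \<phi> z"] bound[OF that] u by (simp add: norm_mult)
    ultimately show ?thesis
      using half_plane_coeff_bound[OF holo exp u, of k "Suc n"] by (simp add: c_def C0)
  qed
  have geo: "(\<lambda>n. 2 * (k - c 0) * r ^ Suc n) sums (2 * (k - c 0) * (r / (1 - r)))"
    using r sums_mult[OF geometric_sums[of r], of "2 * (k - c 0) * r"] by (simp add: mult_ac)
  have le: "c (Suc n) * r ^ Suc n \<le> 2 * (k - c 0) * r ^ Suc n" for n
    using cn r by (intro mult_right_mono) auto
  have sumS: "summable (\<lambda>n. c (Suc n) * r ^ Suc n)"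
    by (rule summable_comparison_test'[OF sums_summable[OF geo], of 0])
       (use le r in \<open>auto simp: c_def\<close>)
  then show summ: "summable (\<lambda>n. cmod (fps_nth C n) * r ^ n)"
    unfolding c_def by (subst (asm) summable_Suc_iff)
  have "(\<Sum>n. c n * r ^ n) = c 0 + (\<Sum>n. c (Suc n) * r ^ Suc n)"
    using suminf_split_head[OF summ] by (simp add: c_def)
  also have "\<dots> \<le> c 0 + 2 * (k - c 0) * (r / (1 - r))"
    using suminf_le[OF le sumS sums_summable[OF geo]] sums_unique[OF geo] by simp
  also have "\<dots> \<le> c 0 + (k - c 0) * 1"
  proof -
    \<comment> \<open>This is where Bohr's radius 1/3 enters.\<close>
    have "2 * (r / (1 - r)) \<le> 1" using r by (simp add: field_simps)
    then show ?thesis using c0 mult_left_mono[of "2 * (r / (1 - r))" 1 "k - c 0"] by (simp add: mult_ac)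
  qed
  finally show "(\<Sum>n. cmod (fps_nth C n) * r ^ n) \<le> k" by (simp add: c_def)
qed

text \<open>With \<open>g' = \<phi> h'\<close> the coefficients satisfy \<open>(n+1) b\<^sub>n\<^sub>+\<^sub>1 = \<Sum>\<^sub>i\<^sub>\<le>\<^sub>n c\<^sub>i (n-i+1) a\<^sub>n\<^sub>-\<^sub>i\<^sub>+\<^sub>1\<close>, and since
  \<open>(n-i+1)/(n+1) \<le> 1\<close> the majorant series of \<open>g\<close> is dominated by the product of those of \<open>\<phi>\<close>
  and \<open>h\<close>.\<close>

lemma dilatation_majorant_le:
  assumes holo: "h holomorphic_on ball 0 1" "g holomorphic_on ball 0 1"
    and expA: "h has_fps_expansion A" and expB: "g has_fps_expansion B"
    and nz: "\<And>z. z \<in> ball 0 1 \<Longrightarrow> deriv h z \<noteq> 0"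
    and dil: "\<And>z. z \<in> ball 0 1 \<Longrightarrow> cmod (deriv g z) \<le> k * cmod (deriv h z)"
    and r: "0 \<le> r" "r \<le> 1/3"
    and sumA: "summable (\<lambda>n. cmod (fps_nth A (Suc n)) * r ^ Suc n)"
  shows "summable (\<lambda>n. cmod (fps_nth B (Suc n)) * r ^ Suc n)"
    and "(\<Sum>n. cmod (fps_nth B (Suc n)) * r ^ Suc n)
      \<le> k * (\<Sum>n. cmod (fps_nth A (Suc n)) * r ^ Suc n)"
proof -
  define \<phi> where "\<phi> z = deriv g z / deriv h z" for z
  define C where "C = fps_expansion \<phi> 0"
  have hol\<phi>: "\<phi> holomorphic_on ball 0 1"
    unfolding \<phi>_def using nz by (intro holomorphic_intros holo) auto
  have exp\<phi>: "\<phi> has_fps_expansion C"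
    unfolding C_def by (rule has_fps_expansion_fps_expansion[OF _ _ hol\<phi>]) auto
  have bound\<phi>: "cmod (\<phi> z) \<le> k" if "z \<in> ball 0 1" for z
    using dil[OF that] nz[OF that] by (simp add: \<phi>_def norm_divide field_simps)
  note C = bohr_majorant_le[OF hol\<phi> exp\<phi> bound\<phi> r]
  have prod: "(\<lambda>z. \<phi> z * deriv h z) has_fps_expansion C * fps_deriv A"
    by (intro fps_expansion_intros exp\<phi> expA)
  \<comment> \<open>The relation between \<open>deriv g\<close> and \<open>deriv h\<close> near 0 is
    enough to identify the formal power series.\<close>
  have "eventually (\<lambda>z. z \<in> ball 0 (1::real)) (nhds (0::complex))"
    by (rule eventually_nhds_in_open) auto
  then have ev: "eventually (\<lambda>z. \<phi> z * deriv h z = deriv g z) (nhds 0)"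
    by eventually_elim (use nz in \<open>auto simp: \<phi>_def\<close>)
  have "deriv g has_fps_expansion C * fps_deriv A"
    using has_fps_expansion_cong[OF ev refl] prod by blast
  moreover have "deriv g has_fps_expansion fps_deriv B"
    by (intro fps_expansion_intros expB)
  ultimately have eq: "fps_deriv B = C * fps_deriv A"
    by (rule fps_expansion_unique_complex[rotated])
  \<comment> \<open>The index is shifted: \<open>a n\<close> is the term of degree
    \<open>n + 1\<close>. This matches the coefficients of the derivative and lets
    \<open>r ^ Suc n\<close> split as \<open>r ^ i * r ^ Suc (n - i)\<close> in the Cauchy
    product.\<close>
  define a where "a n = cmod (fps_nth A (Suc n)) * r ^ Suc n" for n
  define c where "c n = cmod (fps_nth C n) * r ^ n" for n
  have a0: "a n \<ge> 0" and c0: "c n \<ge> 0" for n using r by (auto simp: a_def c_def)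
  have le: "cmod (fps_nth B (Suc n)) * r ^ Suc n \<le> (\<Sum>i\<le>n. c i * a (n - i))" for n
  proof -
    have "fps_nth (fps_deriv B) n = (\<Sum>i\<le>n. fps_nth C i * (of_nat (n - i + 1) * fps_nth A (n - i + 1)))"
      unfolding eq fps_mult_nth by (simp add: atLeast0AtMost)
    then have "cmod (of_nat (n + 1) * fps_nth B (n + 1)) \<le>
        (\<Sum>i\<le>n. cmod (fps_nth C i * (of_nat (n - i + 1) * fps_nth A (n - i + 1))))"
      by (simp add: norm_sum del: of_nat_add of_nat_Suc)
    also have "\<dots> \<le> (\<Sum>i\<le>n. real (n + 1) * (cmod (fps_nth C i) * cmod (fps_nth A (n - i + 1))))"
    proof (rule sum_mono)
      fix i
      have "real (n - i + 1) * (cmod (fps_nth C i) * cmod (fps_nth A (n - i + 1))) \<le>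
          real (n + 1) * (cmod (fps_nth C i) * cmod (fps_nth A (n - i + 1)))"
        by (intro mult_right_mono) auto
      then show "cmod (fps_nth C i * (of_nat (n - i + 1) * fps_nth A (n - i + 1))) \<le>
          real (n + 1) * (cmod (fps_nth C i) * cmod (fps_nth A (n - i + 1)))"
        unfolding norm_mult norm_of_nat by (simp only: mult_ac)
    qed
    finally have "real (n + 1) * cmod (fps_nth B (n + 1)) \<le>
        real (n + 1) * (\<Sum>i\<le>n. cmod (fps_nth C i) * cmod (fps_nth A (n - i + 1)))"
      unfolding norm_mult norm_of_nat sum_distrib_left .
    then have "cmod (fps_nth B (n + 1)) \<le> (\<Sum>i\<le>n. cmod (fps_nth C i) * cmod (fps_nth A (n - i + 1)))"
      by (subst (asm) mult_le_cancel_left_pos) auto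
    then have "cmod (fps_nth B (n + 1)) * r ^ Suc n
        \<le> (\<Sum>i\<le>n. cmod (fps_nth C i) * cmod (fps_nth A (n - i + 1))) * r ^ Suc n"
      using r by (intro mult_right_mono) auto
    also have "\<dots> = (\<Sum>i\<le>n. c i * a (n - i))"
      unfolding sum_distrib_right
    proof (rule sum.cong)
      fix i assume "i \<in> {..n}"
      then have "r ^ Suc n = r ^ i * r ^ Suc (n - i)" by (simp flip: power_add)
      then show "cmod (fps_nth C i) * cmod (fps_nth A (n - i + 1)) * r ^ Suc n = c i * a (n - i)"
        by (simp add: a_def c_def)
    qed simp
    finally show ?thesis by simp
  qed
  have cauchy: "(\<lambda>n. \<Sum>i\<le>n. c i * a (n - i)) sums ((\<Sum>n. c n) * (\<Sum>n. a n))"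
    using C(1) sumA a0 c0 by (intro Cauchy_product_sums) (simp_all add: a_def c_def)
  show summ: "summable (\<lambda>n. cmod (fps_nth B (Suc n)) * r ^ Suc n)"
    by (rule summable_comparison_test'[OF sums_summable[OF cauchy], of 0]) (use le r in auto)
  have "(\<Sum>n. cmod (fps_nth B (Suc n)) * r ^ Suc n) \<le> (\<Sum>n. c n) * (\<Sum>n. a n)"
    using suminf_le[OF le summ sums_summable[OF cauchy]] sums_unique[OF cauchy] by simp
  also have "\<dots> \<le> k * (\<Sum>n. a n)"
    using C(2) sumA a0 by (intro mult_right_mono suminf_nonneg) (auto simp: a_def c_def)
  finally show "(\<Sum>n. cmod (fps_nth B (Suc n)) * r ^ Suc n)
      \<le> k * (\<Sum>n. cmod (fps_nth A (Suc n)) * r ^ Suc n)" by (simp add: a_def)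
qed

section \<open>Supporting half-planes of the convex image\<close>

lemma univalent_image_neq_UNIV:
  assumes "\<psi> holomorphic_on ball 0 1" "inj_on \<psi> (ball 0 1)"
  shows "\<psi> ` ball 0 1 \<noteq> (UNIV :: complex set)"
proof
  assume U: "\<psi> ` ball 0 1 = UNIV"
  obtain G where G: "G holomorphic_on \<psi> ` ball 0 1" "\<And>z. z \<in> ball 0 1 \<Longrightarrow> G (\<psi> z) = z"
    using holomorphic_has_inverse[OF assms(1) _ assms(2)] by (metis open_ball)
  \<comment> \<open>If the image were the plane, the inverse of \<psi> would be a bounded entire
    function, which Liouville's theorem forbids.\<close>
  have "range G \<subseteq> ball 0 1" using G(2) unfolding U[symmetric] by auto
  then have "bounded (range G)" using bounded_ball bounded_subset by blast
  then have "G constant_on UNIV" using G(1) U by (intro Liouville_theorem) auto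
  then obtain c where "\<And>w. G w = c" by (auto simp: constant_on_def)
  then have "0 = (1/2 :: complex)" using G(2)[of 0] G(2)[of "1/2"] by simp
  then show False by simp
qed

text \<open>Take a supporting line at a frontier point nearest to \<open>\<psi> 0\<close>; its
  distance from \<open>\<psi> 0\<close> cannot exceed the distance to that point.\<close>

lemma convex_subordinate_half_plane:
  assumes "univalent_convex \<psi>"
  obtains u where "cmod u = 1"
    "\<And>w. w \<in> \<psi> ` \<D> \<Longrightarrow> Re (u * w) \<le> Re (u * \<psi> 0) + infdist (\<psi> 0) (frontier (\<psi> ` \<D>))"
proof -
  let ?V = "\<psi> ` \<D>"
  have hol: "\<psi> holomorphic_on \<D>" and inj: "inj_on \<psi> \<D>" and conv: "convex ?V"
    using assms by (auto simp: univalent_convex_def)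
  have op: "open ?V" by (rule open_mapping_thm3[OF hol open_ball inj])
  have "?V \<noteq> {}" by auto
  then have "frontier ?V \<noteq> {}"
    using univalent_image_neq_UNIV[OF hol inj] by (simp add: frontier_eq_empty)
  then obtain w0 where w0: "w0 \<in> frontier ?V" "infdist (\<psi> 0) (frontier ?V) = dist (\<psi> 0) w0"
    using infdist_attains_inf[OF frontier_closed] by metis
  \<comment> \<open>Openness of the image keeps \<open>w0\<close> outside it, so a hyperplane
    through \<open>w0\<close> can be separated from the convex set.\<close>
  have "w0 \<notin> ?V" using w0(1) op by (auto simp: frontier_def interior_open)
  then have "0 \<notin> (\<lambda>w. w - w0) ` ?V" by auto
  moreover have "convex ((\<lambda>w. w - w0) ` ?V)"
    using conv by (rule convex_translation_subtract)
  ultimately obtain a where a: "a \<noteq> 0" "\<And>w. w \<in> ?V \<Longrightarrow> 0 \<le> inner a (w - w0)"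
    using separating_hyperplane_set_0[of "(\<lambda>w. w - w0) ` ?V"] by blast
  \<comment> \<open>The outward unit normal, conjugated so that multiplication by \<open>u\<close>
    expresses the inner product as a real part.\<close>
  define u where "u = - cnj a / cmod a"
  have u: "cmod u = 1" using a(1) by (simp add: u_def norm_divide)
  have Re_u: "Re (u * w) = - inner a w / cmod a" for w
    by (simp add: u_def inner_complex_def diff_divide_distrib add_divide_distrib)
  have "Re (u * w) \<le> Re (u * \<psi> 0) + infdist (\<psi> 0) (frontier ?V)" if "w \<in> ?V" for w
  proof -
    have "Re (u * w) \<le> Re (u * w0)"
      using a(2)[OF that] a(1) unfolding Re_u by (simp add: inner_diff_right divide_right_mono)
    also have "\<dots> = Re (u * \<psi> 0) + Re (u * (w0 - \<psi> 0))" by (simp add: algebra_simps)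
    also have "Re (u * (w0 - \<psi> 0)) \<le> cmod (u * (w0 - \<psi> 0))" by (rule complex_Re_le_cmod)
    also have "\<dots> = infdist (\<psi> 0) (frontier ?V)"
      using u w0(2) by (simp add: norm_mult dist_norm norm_minus_commute)
    finally show ?thesis by simp
  qed
  with u that show ?thesis by blast
qed

section \<open>The Bohr inequality\<close>

lemma has_fps_expansion_of_power_series:
  assumes "\<And>z. z \<in> \<D> \<Longrightarrow> (\<lambda>n. a n * z ^ n) sums h z"
  shows "h has_fps_expansion Abs_fps a"
proof (rule has_fps_expansionI)
  have "eventually (\<lambda>z. z \<in> ball 0 (1::real)) (nhds (0::complex))"
    by (rule eventually_nhds_in_open) auto
  then show "eventually (\<lambda>u. (\<lambda>n. fps_nth (Abs_fps a) n * u ^ n) sums h u) (nhds 0)"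
    by eventually_elim (use assms in auto)
qed

lemma bohr_inequality_quasiconformal:
  assumes K: "K \<ge> 1" and hyp: "bohr_hypotheses K f h g a b \<psi>"
    and z: "cmod z \<le> (K + 1) / (7 * K + 3)"
  shows "bohr_inequality h a b \<psi> z"
proof -
  define k where "k = (K - 1) / (K + 1)"
  define r where "r = cmod z"
  define d where "d = infdist (\<psi> 0) (frontier (\<psi> ` \<D>))"
  have harm: "harmonic_mapping f h g"
    and sums_h: "\<And>z. z \<in> \<D> \<Longrightarrow> (\<lambda>n. a n * z ^ n) sums h z"
    and sums_g: "\<And>z. z \<in> \<D> \<Longrightarrow> (\<lambda>n. b (Suc n) * z ^ Suc n) sums g z"
    and sp: "sense_preserving f" and qc: "quasiconformal K f"
    and \<psi>: "univalent_convex \<psi>" and sub: "h \<prec>\<^sub>s \<psi>"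
    using hyp by (auto simp: bohr_hypotheses_def)
  have holo: "h holomorphic_on \<D>" "g holomorphic_on \<D>"
    using harm by (auto simp: harmonic_mapping_def)
  \<comment> \<open>The radius is largest at \<open>K = 1\<close>; being below 1/3, it lets the
    majorant bound for the dilatation apply.\<close>
  have "(K + 1) / (7 * K + 3) \<le> 1/5" using K by (simp add: field_simps)
  then have "r \<le> 1/5" unfolding r_def using z by linarith
  then have r: "0 \<le> r" "r \<le> 1/5" by (simp_all add: r_def)
  have k: "0 \<le> k" using K by (simp add: k_def)
  have jac: "(cmod (deriv g w))\<^sup>2 < (cmod (deriv h w))\<^sup>2" if "w \<in> \<D>" for w
    using harmonic_mapping_sense_preserving_iff[OF harm] sp that by fastforce
  then have less: "cmod (deriv g w) < cmod (deriv h w)" if "w \<in> \<D>" for w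
    using that by (meson norm_ge_zero power2_less_imp_less)
  have nz: "deriv h w \<noteq> 0" if "w \<in> \<D>" for w
    using less[OF that] by auto
  have dil: "cmod (deriv g w) \<le> k * cmod (deriv h w)" if "w \<in> \<D>" for w
  proof -
    have "(cmod (deriv h w) + cmod (deriv g w)) / (cmod (deriv h w) - cmod (deriv g w)) \<le> K"
      using qc that unfolding quasiconformal_def
      by (metis complex_mod_cnj harmonic_mapping_wirtinger[OF harm that])
    then show ?thesis
      using less[OF that] K by (simp add: k_def divide_simps) (simp add: algebra_simps)
  qed
  define A where "A = Abs_fps a"
  \<comment> \<open>The hypotheses leave \<open>b 0\<close> arbitrary, whereas the expansion of
    \<open>g\<close> has constant term 0.\<close>
  define B where "B = Abs_fps (\<lambda>n. if n = 0 then 0 else b n)"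
  have expA: "h has_fps_expansion A"
    unfolding A_def by (rule has_fps_expansion_of_power_series) (rule sums_h)
  have expB: "g has_fps_expansion B"
    unfolding B_def
  proof (rule has_fps_expansion_of_power_series)
    fix w assume "w \<in> \<D>"
    from sums_Suc[of "\<lambda>n. (if n = 0 then 0 else b n) * w ^ n"] sums_g[OF this]
    show "(\<lambda>n. (if n = 0 then 0 else b n) * w ^ n) sums g w" by simp
  qed
  obtain \<omega> where \<omega>: "\<omega> ` \<D> \<subseteq> \<D>" "\<omega> 0 = 0" "\<And>z. z \<in> \<D> \<Longrightarrow> h z = \<psi> (\<omega> z)"
    using sub by (auto simp: subordinate_def)
  have h0: "h 0 = \<psi> 0" using \<omega>(2) \<omega>(3)[of 0] by simp
  obtain u where u: "cmod u = 1" "\<And>w. w \<in> \<psi> ` \<D> \<Longrightarrow> Re (u * w) \<le> Re (u * \<psi> 0) + d"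
    using convex_subordinate_half_plane[OF \<psi>] unfolding d_def by blast
  \<comment> \<open>By subordination the half-plane containing the image of \<psi> also contains
    that of \<open>h\<close>, and \<open>h 0 = \<psi> 0\<close> makes the gap at the origin exactly
    \<open>d\<close>.\<close>
  have a_le: "cmod (a (Suc n)) \<le> 2 * d" for n
    using half_plane_coeff_bound[OF holo(1) expA u(1), of "Re (u * \<psi> 0) + d" "Suc n"] u(2) \<omega>
    by (force simp: A_def h0)
  have geo: "(\<lambda>n. 2 * d * r ^ Suc n) sums (2 * d * (r / (1 - r)))"
    using r sums_mult[OF geometric_sums[of r], of "2 * d * r"] by (simp add: mult_ac)
  have le: "cmod (a (Suc n)) * r ^ Suc n \<le> 2 * d * r ^ Suc n" for n
    using a_le r by (intro mult_right_mono) auto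
  have sumA: "summable (\<lambda>n. cmod (a (Suc n)) * r ^ Suc n)"
    by (rule summable_comparison_test'[OF sums_summable[OF geo], of 0]) (use le r in auto)
  define SA where "SA = (\<Sum>n. cmod (a (Suc n)) * r ^ Suc n)"
  have SA: "SA \<le> 2 * d * (r / (1 - r))"
    unfolding SA_def using suminf_le[OF le sumA sums_summable[OF geo]] sums_unique[OF geo] by simp
  have sumB: "summable (\<lambda>n. cmod (b (Suc n)) * r ^ Suc n)"
    and SB: "(\<Sum>n. cmod (b (Suc n)) * r ^ Suc n) \<le> k * SA"
    using dilatation_majorant_le[OF holo expA expB nz dil, of r] r sumA
    by (auto simp: A_def B_def SA_def)
  have zD: "z \<in> \<D>" using r by (simp add: r_def)
  have "cmod (h z) \<le> cmod (\<psi> 0) + SA"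
  proof -
    have *: "(\<lambda>n. a (Suc n) * z ^ Suc n) sums (h z - a 0)"
      using sums_Suc_iff[of "\<lambda>n. a n * z ^ n" "h z - a 0"] sums_h[OF zD] by simp
    have "a 0 = \<psi> 0" using fps_nth_fps_expansion[OF expA, of 0] by (simp add: A_def h0)
    moreover have "cmod (h z - a 0) \<le> SA"
      unfolding SA_def sums_unique[OF *]
      using summable_norm[of "\<lambda>n. a (Suc n) * z ^ Suc n"] sumA
      by (simp add: norm_mult norm_power r_def)
    ultimately show ?thesis
      using norm_triangle_sub[of "h z" "\<psi> 0"] by simp
  qed
  moreover have "(\<Sum>n. (cmod (a (Suc n)) + cmod (b (Suc n))) * r ^ Suc n)
      = SA + (\<Sum>n. cmod (b (Suc n)) * r ^ Suc n)"
    unfolding SA_def using suminf_add[OF sumA sumB] by (simp add: distrib_right)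
  ultimately have "cmod (h z) + (\<Sum>n. (cmod (a (Suc n)) + cmod (b (Suc n))) * r ^ Suc n)
      \<le> cmod (\<psi> 0) + (2 + k) * SA"
    using SB by (simp add: algebra_simps)
  \<comment> \<open>In the factor \<open>2 + k\<close>, one unit comes from
    \<open>cmod (h z)\<close>, one from the coefficients of \<open>h\<close>, and \<open>k\<close>
    from those of \<open>g\<close>. After clearing denominators the claim reads
    \<open>2 (3 K + 1) r \<le> (1 - r) (K + 1)\<close>, that is
    \<open>(7 K + 3) r \<le> K + 1\<close>.\<close>
  also have "(2 + k) * SA \<le> d"
  proof -
    have d0: "d \<ge> 0" by (simp add: d_def infdist_nonneg)
    have "(7 * K + 3) * r \<le> K + 1"
      using z K by (simp add: r_def field_simps)
    moreover have "(2 + k) * (K + 1) = 3 * K + 1" using K by (simp add: k_def field_simps)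
    then have "(2 + k) * (2 * r) * (K + 1) = (3 * K + 1) * (2 * r)" by (metis mult.assoc mult.commute)
    ultimately have "(2 + k) * (2 * r) * (K + 1) \<le> (1 - r) * (K + 1)"
      by (simp add: algebra_simps)
    then have "(2 + k) * (2 * r) \<le> 1 - r" using K by simp
    then have "(2 + k) * (2 * (r / (1 - r))) \<le> 1" using r by (simp add: field_simps)
    then have "d * ((2 + k) * (2 * (r / (1 - r)))) \<le> d * 1"
      using d0 by (rule mult_left_mono)
    moreover have "(2 + k) * SA \<le> (2 + k) * (2 * d * (r / (1 - r)))"
      using SA k by (intro mult_left_mono) auto
    ultimately show ?thesis by (simp add: mult_ac)
  qed
  finally show ?thesis
    by (simp add: bohr_inequality_def r_def d_def)
qed

subsection \<open>The extremal function\<close>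

text \<open>All Taylor coefficients of positive degree are 1 and the image is at distance 1/2 from
  leaving the origin, so the coefficient bound \<open>2 d\<close> is attained in every
  degree.\<close>

definition half_plane_map :: "complex \<Rightarrow> complex" where
  "half_plane_map z = z / (1 - z)"

text \<open>The inverse is \<open>w / (1 + w)\<close>, so the image consists of the points closer to
  0 than to -1.\<close>

lemma half_plane_map_image: "half_plane_map ` \<D> = {w. Re w > - 1/2}"
  and half_plane_map_inverse: "z \<in> \<D> \<Longrightarrow> half_plane_map z / (1 + half_plane_map z) = z"
proof -
  show inv: "half_plane_map z / (1 + half_plane_map z) = z" if "z \<in> \<D>" for z
  proof -
    have "z \<noteq> 1" using that by auto
    then have "1 + half_plane_map z = 1 / (1 - z)" by (simp add: half_plane_map_def field_simps)
    then show ?thesis using \<open>z \<noteq> 1\<close> by (simp add: half_plane_map_def)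
  qed
  have sq: "(cmod w)\<^sup>2 < (cmod (1 + w))\<^sup>2 \<longleftrightarrow> Re w > - 1/2" for w
  proof -
    have "(cmod (1 + w))\<^sup>2 - (cmod w)\<^sup>2 = 1 + 2 * Re w"
      unfolding cmod_power2 by (simp add: power2_eq_square algebra_simps)
    then show ?thesis by linarith
  qed
  have lt: "cmod w < cmod (1 + w) \<longleftrightarrow> Re w > - 1/2" for w
    using sq[of w] by (meson norm_ge_zero power_strict_mono power2_less_imp_less zero_less_numeral)
  show "half_plane_map ` \<D> = {w. Re w > - 1/2}"
  proof (intro equalityI subsetI)
    fix w assume "w \<in> half_plane_map ` \<D>"
    then obtain z where z: "z \<in> \<D>" "w = half_plane_map z" by auto
    have "z \<noteq> 1" using z by auto
    then have "1 + w = 1 / (1 - z)" "w = z / (1 - z)"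
      by (simp_all add: z half_plane_map_def field_simps)
    then have "cmod w < cmod (1 + w)"
      using z \<open>z \<noteq> 1\<close> by (simp add: norm_divide divide_strict_right_mono)
    then show "w \<in> {w. Re w > - 1/2}" by (simp add: lt)
  next
    fix w assume "w \<in> {w. Re w > - 1/2}"
    then have w: "Re w > - 1/2" by simp
    then have "1 + w \<noteq> 0" by (auto simp: complex_eq_iff)
    then have "w / (1 + w) \<in> \<D>" "w = half_plane_map (w / (1 + w))"
      using lt[of w] w by (auto simp: norm_divide half_plane_map_def field_simps)
    then show "w \<in> half_plane_map ` \<D>" by blast
  qed
qed

lemma half_plane_map_holomorphic: "half_plane_map holomorphic_on \<D>"
  unfolding half_plane_map_def by (intro holomorphic_intros) auto

lemma half_plane_map_has_field_derivative:
  assumes "z \<in> \<D>"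
  shows "(half_plane_map has_field_derivative 1 / (1 - z)\<^sup>2) (at z)"
proof -
  have "z \<noteq> 1" using assms by auto
  then show ?thesis
    unfolding half_plane_map_def
    by (auto intro!: derivative_eq_intros simp: power2_eq_square)
qed

lemma half_plane_map_sums:
  assumes "z \<in> \<D>"
  shows "(\<lambda>n. z ^ Suc n) sums half_plane_map z"
proof -
  have "(\<lambda>n. z ^ n) sums (1 / (1 - z))"
    using assms by (intro geometric_sums) simp
  from sums_mult[OF this, of z] show ?thesis
    by (simp add: half_plane_map_def)
qed

lemma univalent_convex_half_plane_map: "univalent_convex half_plane_map"
  unfolding univalent_convex_def
proof (intro conjI)
  show "inj_on half_plane_map \<D>"
    using half_plane_map_inverse by (rule inj_on_inverseI)
  have "{w. Re w > - 1/2} = {w. inner 1 w > - 1/2}" by (simp add: inner_complex_def)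
  then show "convex (half_plane_map ` \<D>)"
    unfolding half_plane_map_image by (simp only: convex_halfspace_gt)
qed (rule half_plane_map_holomorphic)

text \<open>The frontier point -1/2 witnesses this; an upper bound for the right-hand side is what a
  counterexample calls for.\<close>

lemma infdist_frontier_half_plane_map:
  "infdist (half_plane_map 0) (frontier (half_plane_map ` \<D>)) \<le> 1/2"
proof -
  have "{w. Re w > - 1/2} = {w. inner 1 w > - 1/2}" by (simp add: inner_complex_def)
  then have "frontier (half_plane_map ` \<D>) = {w. inner 1 w = - 1/2}"
    unfolding half_plane_map_image by (simp only:) (rule frontier_halfspace_gt, simp)
  then have "- 1/2 \<in> frontier (half_plane_map ` \<D>)" by (simp add: inner_complex_def)
  from infdist_le[OF this, of "half_plane_map 0"] show ?thesis
    by (simp add: half_plane_map_def dist_norm)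
qed

lemma bohr_hypotheses_half_plane_map:
  fixes K :: real
  defines "k \<equiv> (K - 1) / (K + 1)"
  assumes K: "K \<ge> 1"
  \<comment> \<open>The dilatation is the constant \<open>k\<close>, which makes the
    quasiconformality quotient equal to \<open>K\<close> everywhere.\<close>
  shows "bohr_hypotheses K (\<lambda>z. half_plane_map z + cnj (of_real k * half_plane_map z))
    half_plane_map (\<lambda>z. of_real k * half_plane_map z)
    (\<lambda>n. of_bool (n > 0)) (\<lambda>n. of_real k) half_plane_map"
proof -
  define h where "h = half_plane_map"
  define f where "f z = h z + cnj (of_real k * h z)" for z
  define g where "g z = of_real k * h z" for z
  have k: "0 \<le> k" "k < 1" using K by (auto simp: k_def field_simps)
  have holo: "h holomorphic_on \<D>" "g holomorphic_on \<D>"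
    unfolding g_def h_def by (auto intro!: holomorphic_intros half_plane_map_holomorphic)
  have h0: "h 0 = 0" by (simp add: h_def half_plane_map_def)
  have harm: "harmonic_mapping f h g"
    using holo by (simp add: harmonic_mapping_def f_def g_def h0)
  have dh: "deriv h z = 1 / (1 - z)\<^sup>2" if "z \<in> \<D>" for z
    unfolding h_def using half_plane_map_has_field_derivative[OF that] by (rule DERIV_imp_deriv)
  have dh0: "deriv h z \<noteq> 0" if "z \<in> \<D>" for z using that dh by auto
  have dg: "deriv g z = of_real k * deriv h z" if "z \<in> \<D>" for z
    unfolding g_def using holo(1) that
    by (intro deriv_cmult) (auto simp: holomorphic_on_imp_differentiable_at)
  have norm_dg: "cmod (deriv g z) = k * cmod (deriv h z)" if "z \<in> \<D>" for z
    using dg[OF that] k by (simp add: norm_mult)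
  have sp: "sense_preserving f"
    unfolding harmonic_mapping_sense_preserving_iff[OF harm]
  proof
    fix z :: complex assume z: "z \<in> \<D>"
    have "k * cmod (deriv h z) < 1 * cmod (deriv h z)"
      using k dh0[OF z] by (intro mult_strict_right_mono) auto
    then have "(k * cmod (deriv h z))\<^sup>2 < (cmod (deriv h z))\<^sup>2"
      using k by (intro power_strict_mono) auto
    then show "(cmod (deriv h z))\<^sup>2 - (cmod (deriv g z))\<^sup>2 > 0"
      by (simp add: norm_dg[OF z])
  qed
  \<comment> \<open>This real-linear map stretches the real axis by \<open>1 + k\<close> and the
    imaginary axis by \<open>1 - k\<close>. As \<open>k < 1\<close> it is invertible, so
    \<open>f\<close>, its composition with \<open>h\<close>, is a homeomorphism onto another
    half-plane.\<close>
  define L where "L w = w + cnj (of_real k * w)" for w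
  define L' where "L' w = Complex (Re w / (1 + k)) (Im w / (1 - k))" for w
  have L: "L w = Complex ((1 + k) * Re w) ((1 - k) * Im w)" for w
    by (simp add: L_def complex_eq_iff algebra_simps)
  have L'L: "L' (L w) = w" and LL': "L (L' w) = w" for w
    using k by (simp_all add: L L'_def)
  have f: "f z = L (h z)" for z by (simp add: f_def L_def)
  have image: "f ` \<D> = {w. Re w > - (1 + k) / 2}"
  proof -
    have "f ` \<D> = L ` {w. Re w > - 1/2}"
      unfolding half_plane_map_image[folded h_def, symmetric] by (auto simp: f)
    also have "\<dots> = {w. Re w > - (1 + k) / 2}"
    proof (intro equalityI subsetI)
      fix w assume "w \<in> L ` {w. Re w > - 1/2}"
      then obtain v where v: "w = L v" "Re v > - 1/2" by auto
      then have "(1 + k) * Re v > (1 + k) * (- 1/2)"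
        using k by (intro mult_strict_left_mono) auto
      moreover have "(1 + k) * (- 1/2) = - (1 + k) / 2" by linarith
      ultimately have "Re w > - (1 + k) / 2" unfolding v(1) L complex.sel by linarith
      then show "w \<in> {w. Re w > - (1 + k) / 2}" by simp
    next
      fix w assume "w \<in> {w. Re w > - (1 + k) / 2}"
      then have "Re (L' w) > - 1/2" using k by (simp add: L'_def field_simps)
      then show "w \<in> L ` {w. Re w > - 1/2}" using LL'[of w] by (metis mem_Collect_eq image_eqI)
    qed
    finally show ?thesis .
  qed
  have half: "{w. Re w > - (1 + k) / 2} = {w. inner 1 w > - (1 + k) / 2}"
    by (simp add: inner_complex_def)
  have dom: "open (f ` \<D>)" "connected (f ` \<D>)"
    unfolding image half by (simp_all only: open_halfspace_gt convex_halfspace_gt convex_connected)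
  define f' where "f' w = L' w / (1 + L' w)" for w
  have f'f: "f' (f z) = z" if "z \<in> \<D>" for z
    using half_plane_map_inverse[OF that] by (simp add: f'_def f L'L h_def)
  have cont_L': "continuous_on UNIV L'"
    unfolding L'_def complex_eq_iff using k
    by (intro continuous_on_Complex continuous_intros) auto
  have L'_nz: "1 + L' w \<noteq> 0" if "w \<in> f ` \<D>" for w
  proof -
    have "Re (L' w) > - 1/2" using that k unfolding image by (simp add: L'_def field_simps)
    then show ?thesis by (auto simp: complex_eq_iff)
  qed
  have cont_f: "continuous_on \<D> f"
    unfolding f_def by (intro continuous_intros holomorphic_on_imp_continuous_on holo(1))
  have hom: "homeomorphism \<D> (f ` \<D>) f f'"
  proof (rule homeomorphismI)
    show "continuous_on (f ` \<D>) f'"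
      unfolding f'_def using L'_nz
      by (intro continuous_intros continuous_on_subset[OF cont_L']) auto
  qed (use cont_f f'f in auto)
  have cont_deriv: "continuous_on \<D> (deriv h)" "continuous_on \<D> (deriv g)"
    using holo by (auto intro!: holomorphic_on_imp_continuous_on holomorphic_deriv)
  have sob: "sobolev_1_2_loc \<D> f"
    by (rule C1_imp_sobolev_1_2_loc[OF open_ball harmonic_mapping_has_derivative[OF harm]])
       (assumption | intro continuous_intros cont_deriv)+
  have "quasiconformal K f"
    unfolding quasiconformal_def
  proof (intro conjI ballI)
    fix z :: complex assume z: "z \<in> \<D>"
    have "(1 + k) / (1 - k) = K" using K by (simp add: k_def field_simps)
    moreover have "cmod (deriv h z) > 0" using dh0[OF z] by simp
    ultimately have "((1 + k) * cmod (deriv h z)) / ((1 - k) * cmod (deriv h z)) = K" by simp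
    then show "(cmod (wirtinger f z) + cmod (wirtinger_bar f z)) /
        (cmod (wirtinger f z) - cmod (wirtinger_bar f z)) \<le> K"
      by (simp add: harmonic_mapping_wirtinger[OF harm z] norm_dg[OF z] algebra_simps)
  qed (use sp dom hom sob in blast)+
  moreover have "h \<prec>\<^sub>s h"
    unfolding subordinate_def by (rule exI[of _ id]) auto
  moreover have "(\<lambda>n. of_bool (n > 0) * z ^ n) sums h z" if "z \<in> \<D>" for z
    using sums_Suc[of "\<lambda>n. of_bool (n > 0) * z ^ n"] half_plane_map_sums[OF that]
    by (simp add: h_def)
  moreover have "(\<lambda>n. of_real k * z ^ Suc n) sums g z" if "z \<in> \<D>" for z
    unfolding g_def h_def by (rule sums_mult[OF half_plane_map_sums[OF that]])
  ultimately have "bohr_hypotheses K f h g (\<lambda>n. of_bool (n > 0)) (\<lambda>n. of_real k) h"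
    using harm sp univalent_convex_half_plane_map
    by (simp add: bohr_hypotheses_def h_def)
  then show ?thesis
    by (simp add: f_def[abs_def] g_def[abs_def] h_def)
qed

text \<open>At a positive real point every term is nonnegative and no triangle inequality loses
  anything: the left-hand side equals \<open>(2 + k) r / (1 - r)\<close>, which exceeds 1/2 beyond
  the critical radius.\<close>

lemma bohr_inequality_half_plane_map_fails:
  fixes K :: real
  defines "k \<equiv> (K - 1) / (K + 1)"
  assumes K: "K \<ge> 1" and r: "(K + 1) / (7 * K + 3) < r" "r < 1"
  shows "\<not> bohr_inequality half_plane_map (\<lambda>n. of_bool (n > 0)) (\<lambda>n. of_real k) half_plane_map
    (of_real r)"
proof
  assume *: "bohr_inequality half_plane_map (\<lambda>n. of_bool (n > 0)) (\<lambda>n. of_real k) half_plane_map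
    (of_real r)"
  have "0 < (K + 1) / (7 * K + 3)" using K by simp
  then have r0: "0 < r" using r by linarith
  have k: "0 \<le> k" using K by (simp add: k_def)
  have "(\<lambda>n. (1 + k) * r ^ Suc n) sums ((1 + k) * (r / (1 - r)))"
    using r r0 sums_mult[OF geometric_sums[of r], of "(1 + k) * r"] by (simp add: mult_ac)
  then have "(\<Sum>n. (1 + k) * r ^ Suc n) = (1 + k) * (r / (1 - r))"
    by (rule sums_unique[symmetric])
  moreover have "cmod (half_plane_map (of_real r)) = r / (1 - r)"
  proof -
    have "1 - of_real r = (of_real (1 - r) :: complex)" by simp
    then show ?thesis
      unfolding half_plane_map_def norm_divide using r r0 by (simp only: norm_of_real) simp
  qed
  moreover have "half_plane_map 0 = 0" by (simp add: half_plane_map_def)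
  ultimately have "r / (1 - r) + (1 + k) * (r / (1 - r))
      \<le> infdist (half_plane_map 0) (frontier (half_plane_map ` \<D>))"
    using * r0 k by (simp add: bohr_inequality_def)
  also note infdist_frontier_half_plane_map
  also have "r / (1 - r) + (1 + k) * (r / (1 - r)) = (2 + k) * (r / (1 - r))"
    by (simp add: add_divide_distrib[symmetric] algebra_simps)
  finally have "(2 + k) * (r / (1 - r)) \<le> 1/2" .
  then have "(2 + k) * (2 * r) \<le> 1 - r" using r by (simp add: field_simps)
  then have "(2 + k) * (2 * r) * (K + 1) \<le> (1 - r) * (K + 1)"
    using K by (intro mult_right_mono) auto
  moreover have "(2 + k) * (K + 1) = 3 * K + 1" using K by (simp add: k_def field_simps)
  then have "(2 + k) * (2 * r) * (K + 1) = (3 * K + 1) * (2 * r)" by (metis mult.assoc mult.commute)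
  ultimately have "(7 * K + 3) * r \<le> K + 1" by (simp add: algebra_simps)
  then show False using r(1) K by (simp add: field_simps)
qed

theorem theorem4p5:
  fixes K :: real
  assumes "K \<ge> 1"
  shows "(\<forall>f h g a b \<psi> z.
            bohr_hypotheses K f h g a b \<psi> \<longrightarrow>
            cmod z \<le> (K + 1) / (7 * K + 3) \<longrightarrow>
            bohr_inequality h a b \<psi> z)
       \<and> (\<forall>R. R > (K + 1) / (7 * K + 3) \<longrightarrow>
            (\<exists>f h g a b \<psi> z.
               bohr_hypotheses K f h g a b \<psi> \<and>
               cmod z < 1 \<and> cmod z \<le> R \<and>
               \<not> bohr_inequality h a b \<psi> z))"
proof (intro conjI allI impI)
  fix f h g :: "complex \<Rightarrow> complex" and a b :: "nat \<Rightarrow> complex" and \<psi> :: "complex \<Rightarrow> complex" and z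
  assume "bohr_hypotheses K f h g a b \<psi>" "cmod z \<le> (K + 1) / (7 * K + 3)"
  with assms show "bohr_inequality h a b \<psi> z"
    by (rule bohr_inequality_quasiconformal)
next
  fix R assume R: "R > (K + 1) / (7 * K + 3)"
  have "(K + 1) / (7 * K + 3) < 1" "0 < (K + 1) / (7 * K + 3)"
    using assms by (auto simp: field_simps)
  \<comment> \<open>\<open>R\<close> may be 1 or more, while the point of failure has to lie in the
    disc.\<close>
  with R obtain r where r: "(K + 1) / (7 * K + 3) < r" "r < 1" "r < R" "0 < r"
    using dense[of "(K + 1) / (7 * K + 3)" "min R 1"] by force
  show "\<exists>f h g a b \<psi> z. bohr_hypotheses K f h g a b \<psi> \<and> cmod z < 1 \<and> cmod z \<le> R \<and>
      \<not> bohr_inequality h a b \<psi> z"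
  proof (intro exI conjI)
    show "cmod (of_real r) < 1" "cmod (of_real r) \<le> R" using r by simp_all
  qed (rule bohr_hypotheses_half_plane_map[OF assms] bohr_inequality_half_plane_map_fails[OF assms r(1,2)])+
qed

end
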